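(* As formal power series in $q$ (equivalently, for $|q|<1$), $$\sum_{n=0}^{\infty}a^{o}_{od}(n)q^n=\frac{(-q;q^2)_{\infty}}{(q^2;q^2)_{\infty}} \sum_{n=0}^{\infty} \frac{q^{2n^2+n}}{(-q;q^2)_{n+1}}$$ and $$\sum_{n=0}^{\infty}a^{e}_{od}(n)q^n=\frac{(-q;q^2)_{\infty}}{(q^2;q^2)_{\infty}} \left(v_2(q)-\sum_{n=0}^{\infty}\frac{q^{2n^2+n}}{(-q;q^2)_{n}}\right),$$ where $v_2(q):=\sum_{n=0}^{\infty}\frac{q^{2n^2-n}}{(-q;q^2)_n}$.
   Context: Notation: $(a;q)_0:=1$, $(a;q)_n:=\prod_{k=0}^{n-1}(1-aq^k)$, $(a;q)_\infty:=\lim_{n\to\infty}(a;q)_n$. For $n\ge 0$, $\mathcal{P}_{od}(n)$ is the set of all partitions of $n$ in which no odd part is repeated (each odd part appears at most once; even parts may appear with any multiplicity). The empty partition is the unique element of $\mathcal{P}_{od}(0)$. For a partition $\lambda$, $\mathrm{mex}(\lambda)$ is the smallest positive integer that is not a part of $\lambda$. Define $$a^{o}_{od}(n):=\#\{\lambda\in\mathcal{P}_{od}(n): \mathrm{mex}(\lambda)\equiv 1 \pmod 2\},\qquad a^{e}_{od}(n):=\#\{\lambda\in\mathcal{P}_{od}(n): \mathrm{mex}(\lambda)\equiv 0 \pmod 2\}.$$ *)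

theory Defs
  imports
    Complex_Main
    "HOL-Library.Multiset"
    "HOL-Computational_Algebra.Formal_Power_Series"
begin

definition qpoch :: "'a::comm_ring_1 \<Rightarrow> 'a \<Rightarrow> nat \<Rightarrow> 'a" where
  "qpoch a q n = (\<Prod>k<n. 1 - a * q ^ k)"

definition qpoch_inf :: "'a::{comm_ring_1,t2_space} \<Rightarrow> 'a \<Rightarrow> 'a" where
  "qpoch_inf a q = lim (\<lambda>n. qpoch a q n)"

text \<open>A partition is the multiset of its (positive) parts.\<close>

definition P_od :: "nat \<Rightarrow> nat multiset set" where
  "P_od n = {l. 0 \<notin># l \<and> sum_mset l = n \<and> (\<forall>i. odd i \<longrightarrow> count l i \<le> 1)}"

definition mex :: "nat multiset \<Rightarrow> nat" where
  "mex l = (LEAST m. 0 < m \<and> m \<notin># l)"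

definition a_od_o :: "nat \<Rightarrow> nat" where
  "a_od_o n = card {l \<in> P_od n. odd (mex l)}"

definition a_od_e :: "nat \<Rightarrow> nat" where
  "a_od_e n = card {l \<in> P_od n. even (mex l)}"

abbreviation q :: "rat fps" where
  "q \<equiv> fps_X"

definition v2 :: "rat fps" where
  "v2 = (\<Sum>n. q ^ (2 * n\<^sup>2 - n) / qpoch (- q) (q\<^sup>2) n)"

text \<open>
  The operators \<^const>\<open>lim\<close>, \<^const>\<open>suminf\<close> and \<^const>\<open>card\<close> return junk values on divergent
  sequences and infinite sets. The following facts show that this does not happen here: limits and
  sums are taken in the metric of formal power series, where convergence means that every
  coefficient is eventually constant.
\<close>

lemma finite_P_od: "finite (P_od n)"
proof (rule finite_subset)
  show "P_od n \<subseteq> (\<Union>k\<in>{..n}. multisets_of_size {..n} k)"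
  proof
    fix l assume l: "l \<in> P_od n"
    have "1 \<le> x" if "x \<in># l" for x
      using l that by (cases x) (auto simp: P_od_def)
    hence "(\<Sum>x\<in>#l. 1) \<le> (\<Sum>x\<in>#l. x)"
      by (rule sum_mset_mono)
    hence "size l \<le> n"
      using l by (simp add: P_od_def)
    moreover have "set_mset l \<subseteq> {..n}"
      using l by (auto simp: P_od_def dest!: multi_member_split)
    ultimately show "l \<in> (\<Union>k\<in>{..n}. multisets_of_size {..n} k)"
      by (auto simp: multisets_of_size_def)
  qed
  show "finite (\<Union>k\<in>{..n}. multisets_of_size {..n} k)"
    by auto
qed

lemma convergent_fpsI:
  fixes s :: "nat \<Rightarrow> 'a::comm_ring_1 fps"
  assumes "\<And>n k. n \<le> k \<Longrightarrow> fps_nth (s (Suc k)) n = fps_nth (s k) n"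
  shows "convergent s"
proof (rule convergentI)
  have eq: "fps_nth (s k) n = fps_nth (s n) n" if "n \<le> k" for n k
    using that by (induction k rule: dec_induct) (auto simp: assms)
  show "s \<longlonglongrightarrow> Abs_fps (\<lambda>n. fps_nth (s n) n)"
    unfolding tendsto_fps_iff eventually_sequentially fps_nth_Abs_fps using eq by blast
qed

lemma convergent_qpoch_fps:
  fixes a :: "rat fps"
  assumes "fps_nth a 0 = 0"
  shows "convergent (qpoch a (q\<^sup>2))"
proof (rule convergent_fpsI)
  fix n k :: nat assume "n \<le> k"
  have "qpoch a (q\<^sup>2) (Suc k) = qpoch a (q\<^sup>2) k - q ^ (2 * k) * (a * qpoch a (q\<^sup>2) k)"
    by (simp add: qpoch_def algebra_simps flip: power_mult)
  moreover have "fps_nth (q ^ (2 * k) * (a * qpoch a (q\<^sup>2) k)) n = 0"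
    using \<open>n \<le> k\<close> assms by (cases "n = 0") (auto simp: fps_X_power_mult_nth)
  ultimately show "fps_nth (qpoch a (q\<^sup>2) (Suc k)) n = fps_nth (qpoch a (q\<^sup>2) k) n"
    by simp
qed

lemma qpoch_nth_0: "fps_nth (qpoch (- q) (q\<^sup>2) m) 0 = 1"
  by (induction m) (auto simp: qpoch_def)

lemma summable_fps_X_power_div_qpoch:
  assumes "\<And>n. n \<le> e n"
  shows "summable (\<lambda>n. q ^ e n / qpoch (- q) (q\<^sup>2) (m n))"
proof -
  let ?t = "\<lambda>n. q ^ e n / qpoch (- q) (q\<^sup>2) (m n)"
  have "fps_nth (?t k) n = 0" if "n < k" for n k
  proof -
    have "?t k = q ^ e k * inverse (qpoch (- q) (q\<^sup>2) (m k))"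
      by (simp add: fps_divide_unit qpoch_nth_0)
    thus ?thesis
      using that assms[of k] by (simp add: fps_X_power_mult_nth)
  qed
  hence "convergent (\<lambda>N. \<Sum>n<Suc N. ?t n)"
    by (intro convergent_fpsI) simp
  thus ?thesis
    unfolding summable_iff_convergent
    by (subst (asm) convergent_Suc_iff[where f = "\<lambda>N. \<Sum>n<N. ?t n"])
qed

end

theory Submission
  imports Defs
begin

text \<open>
  Fix the value \<open>m\<close> of the mex. Parts below \<open>m\<close> must occur, \<open>m\<close> itself must not, and larger parts
  are free, so the generating function is a product over the part sizes. Compared with the product
  \<open>(-q;q\<^sup>2)\<^sub>\<infinity> / (q\<^sup>2;q\<^sup>2)\<^sub>\<infinity>\<close> for all of \<open>P_od\<close>, an odd part \<open>i < m\<close> contributes the factor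
  \<open>q^i / (1 + q^i)\<close> and an even one \<open>q^i\<close>, while \<open>i = m\<close> contributes \<open>1 / (1 + q^m)\<close> or \<open>1 - q^m\<close>.
  Hence \<open>m\<close> yields \<open>q^(0 + 1 + \<dots> + (m - 1)) / (-q;q\<^sup>2)\<^bsub>\<lceil>m/2\<rceil>\<^esub>\<close>, times \<open>1 - q^m\<close> if \<open>m\<close> is even. Summing
  over odd and over even \<open>m\<close> gives the two identities; \<open>m = 0\<close> fits the pattern with value \<open>0\<close>.
\<close>

section \<open>Limits and infinite sums of formal power series\<close>

text \<open>Coefficient \<open>n\<close> of a product involves only the coefficients up to
  \<open>n\<close> of the factors; these are finitely many, so all of them are eventually constant
  at once.\<close>

lemma tendsto_fps_mult:
  fixes f g :: "nat \<Rightarrow> 'a::comm_ring_1 fps"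
  assumes "f \<longlonglongrightarrow> a" "g \<longlonglongrightarrow> b"
  shows "(\<lambda>n. f n * g n) \<longlonglongrightarrow> a * b"
  unfolding tendsto_fps_iff
proof
  fix n
  have "\<forall>\<^sub>F k in sequentially. \<forall>i\<in>{..n}. fps_nth (f k) i = fps_nth a i"
    using assms(1) by (intro eventually_ball_finite) (auto simp: tendsto_fps_iff)
  moreover have "\<forall>\<^sub>F k in sequentially. \<forall>i\<in>{..n}. fps_nth (g k) i = fps_nth b i"
    using assms(2) by (intro eventually_ball_finite) (auto simp: tendsto_fps_iff)
  ultimately show "\<forall>\<^sub>F k in sequentially. fps_nth (f k * g k) n = fps_nth (a * b) n"
    by eventually_elim (simp add: fps_mult_nth)
qed

lemma tendsto_fps_diff:
  fixes f g :: "nat \<Rightarrow> 'a::comm_ring_1 fps"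
  assumes "f \<longlonglongrightarrow> a" "g \<longlonglongrightarrow> b"
  shows "(\<lambda>n. f n - g n) \<longlonglongrightarrow> a - b"
  unfolding tendsto_fps_iff
proof
  fix n
  show "\<forall>\<^sub>F k in sequentially. fps_nth (f k - g k) n = fps_nth (a - b) n"
    using assms[unfolded tendsto_fps_iff, rule_format, of n] by eventually_elim simp
qed

lemma sums_fps_mult_left:
  fixes f :: "nat \<Rightarrow> 'a::comm_ring_1 fps"
  assumes "f sums s"
  shows "(\<lambda>n. c * f n) sums (c * s)"
  using tendsto_fps_mult[OF tendsto_const assms[unfolded sums_def]]
  by (simp add: sums_def sum_distrib_left)

lemma sums_fps_diff:
  fixes f g :: "nat \<Rightarrow> 'a::comm_ring_1 fps"
  assumes "f sums s" "g sums t"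
  shows "(\<lambda>n. f n - g n) sums (s - t)"
  using tendsto_fps_diff[OF assms[unfolded sums_def]] by (simp add: sums_def sum_subtractf)

section \<open>Multisets with prescribed multiplicities\<close>

text \<open>For \<open>i > 0\<close> this is the sum of \<open>fps_X ^ (k * i)\<close> over
  \<open>k\<close> in \<open>K\<close>, the allowed multiplicities of part \<open>i\<close>. Giving
  the coefficients directly avoids any convergence question for infinite \<open>K\<close>.\<close>

definition part_gf :: "nat set \<Rightarrow> nat \<Rightarrow> 'a::comm_ring_1 fps" where
  "part_gf K i = Abs_fps (\<lambda>n. if i dvd n \<and> n div i \<in> K then 1 else 0)"

lemma part_gf_0: "i > 0 \<Longrightarrow> part_gf {0} i = 1"
  by (auto simp: part_gf_def fps_eq_iff)

lemma part_gf_1: "i > 0 \<Longrightarrow> part_gf {1} i = fps_X ^ i"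
  by (auto simp: part_gf_def fps_eq_iff fps_X_power_iff elim!: dvdE)

lemma part_gf_0_1: "i > 0 \<Longrightarrow> part_gf {0, 1} i = 1 + fps_X ^ i"
  by (auto simp: part_gf_def fps_eq_iff fps_X_power_iff elim!: dvdE)

lemma part_gf_UNIV: "i > 0 \<Longrightarrow> part_gf UNIV i * (1 - fps_X ^ i) = 1"
  by (auto simp: part_gf_def fps_eq_iff fps_X_power_mult_right_nth right_diff_distrib
      dvd_imp_le dvd_minus_self)

lemma part_gf_pos:
  assumes "i > 0"
  shows "part_gf {0<..} i * (1 - fps_X ^ i) = (fps_X ^ i :: 'a::comm_ring_1 fps)"
proof -
  have "part_gf {0<..} i = (part_gf UNIV i - 1 :: 'a::comm_ring_1 fps)"
    using assms by (auto simp: part_gf_def fps_eq_iff elim!: dvdE)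
  thus ?thesis
    using part_gf_UNIV[OF assms] by (simp add: left_diff_distrib)
qed

definition msets :: "nat set \<Rightarrow> (nat \<Rightarrow> nat set) \<Rightarrow> nat \<Rightarrow> nat multiset set" where
  "msets S C n = {l. set_mset l \<subseteq> S \<and> sum_mset l = n \<and> (\<forall>i\<in>S. count l i \<in> C i)}"

lemma msets_empty: "msets {} C n = (if n = 0 then {{#}} else {})"
  by (auto simp: msets_def)

text \<open>Splits off all copies of \<open>i\<close>, with \<open>k\<close> their number. This is
  the induction step for both finiteness and counting.\<close>

lemma msets_insert:
  assumes "i \<notin> S" "i > 0"
  shows "msets (insert i S) C n =
    (\<Union>k\<in>{k\<in>C i. k * i \<le> n}. (\<lambda>l. l + replicate_mset k i) ` msets S C (n - k * i))"
  (is "_ = ?R")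
proof (intro equalityI subsetI)
  fix l assume l: "l \<in> msets (insert i S) C n"
  define k where "k = count l i"
  define l' where "l' = filter_mset (\<lambda>x. x \<noteq> i) l"
  have split: "l = l' + replicate_mset k i"
    by (simp add: l'_def k_def multiset_eq_iff)
  have "n = sum_mset l' + k * i"
    using l by (subst (asm) split) (simp add: msets_def)
  moreover have "set_mset l' \<subseteq> S"
    using l by (auto simp: l'_def msets_def)
  moreover have "count l' j \<in> C j" if "j \<in> S" for j
    using l that assms by (auto simp: l'_def msets_def)
  ultimately have "l' \<in> msets S C (n - k * i)" "k \<in> C i" "k * i \<le> n"
    using l by (auto simp: msets_def k_def)
  thus "l \<in> ?R"
    using split by blast
next
  fix l assume "l \<in> ?R"
  then obtain k l' where "k \<in> C i" "k * i \<le> n" "l' \<in> msets S C (n - k * i)"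
    and l: "l = l' + replicate_mset k i"
    by blast
  moreover have "count l' i = 0"
    using calculation assms by (auto simp: msets_def count_eq_zero_iff)
  ultimately show "l \<in> msets (insert i S) C n"
    using assms by (auto simp: msets_def split: if_splits)
qed

lemma finite_multiplicities:
  fixes i :: nat
  assumes "i > 0"
  shows "finite {k \<in> K. k * i \<le> n}"
proof (rule finite_subset)
  show "{k \<in> K. k * i \<le> n} \<subseteq> {..n}"
  proof
    fix k assume "k \<in> {k \<in> K. k * i \<le> n}"
    moreover have "k \<le> k * i" using assms by simp
    ultimately show "k \<in> {..n}" unfolding atMost_iff by (blast intro: le_trans)
  qed
qed simp

lemma finite_msets:
  assumes "finite S" "\<forall>i\<in>S. i > 0"
  shows "finite (msets S C n)"
  using assms
proof (induction S arbitrary: n rule: finite_induct)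
  case (insert i S)
  thus ?case
    by (simp add: msets_insert finite_multiplicities)
qed (simp add: msets_empty)

text \<open>Induction on \<open>S\<close>: the pieces of \<open>msets_insert\<close> are disjoint
  because the count of \<open>i\<close> recovers \<open>k\<close>, and adding up their sizes is a
  Cauchy product with \<open>part_gf (C i) i\<close>.\<close>

lemma card_msets:
  assumes "finite S" "\<forall>i\<in>S. i > 0"
  shows "of_nat (card (msets S C n)) = fps_nth (\<Prod>i\<in>S. part_gf (C i) i :: 'a::comm_ring_1 fps) n"
  using assms
proof (induction S arbitrary: n rule: finite_induct)
  case empty
  show ?case by (simp add: msets_empty)
next
  case (insert i S)
  let ?K = "{k\<in>C i. k * i \<le> n}"
  have i: "i > 0" using insert.prems by simp
  have fin: "finite ?K"
    using i by (rule finite_multiplicities)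
  have count_i: "count l i = 0" if "l \<in> msets S C m" for l m
    using that insert.hyps by (auto simp: msets_def count_eq_zero_iff)
  have "card (msets (insert i S) C n) =
      (\<Sum>k\<in>?K. card ((\<lambda>l. l + replicate_mset k i) ` msets S C (n - k * i)))"
    unfolding msets_insert[OF insert.hyps(2) i]
  proof (rule card_UN_disjoint[OF fin])
    show "\<forall>k\<in>?K. finite ((\<lambda>l. l + replicate_mset k i) ` msets S C (n - k * i))"
      using insert by (auto intro: finite_msets)
    show "\<forall>k\<in>?K. \<forall>k'\<in>?K. k \<noteq> k' \<longrightarrow>
        (\<lambda>l. l + replicate_mset k i) ` msets S C (n - k * i) \<inter>
        (\<lambda>l. l + replicate_mset k' i) ` msets S C (n - k' * i) = {}"
    proof (intro ballI impI equals0I)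
      fix k k' x assume "k \<noteq> k'" and "x \<in> (\<lambda>l. l + replicate_mset k i) ` msets S C (n - k * i) \<inter>
        (\<lambda>l. l + replicate_mset k' i) ` msets S C (n - k' * i)"
      then obtain l l' where "x = l + replicate_mset k i" "count l i = 0"
          "x = l' + replicate_mset k' i" "count l' i = 0"
        using count_i by blast
      hence "count x i = k" "count x i = k'"
        by (simp, metis count_replicate_mset count_union add_0)
      thus False using \<open>k \<noteq> k'\<close> by simp
    qed
  qed
  also have "\<dots> = (\<Sum>k\<in>?K. card (msets S C (n - k * i)))"
    by (intro sum.cong refl card_image) (simp add: inj_on_def)
  finally have "of_nat (card (msets (insert i S) C n)) =
      (\<Sum>k\<in>?K. fps_nth (\<Prod>i\<in>S. part_gf (C i) i :: 'a fps) (n - k * i))"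
    using insert by simp
  \<comment> \<open>The new index \<open>d\<close> is the total contributed by the copies of
    \<open>i\<close>. Values of \<open>d\<close> outside the image have coefficient 0 in
    \<open>part_gf (C i) i\<close>, so the range extends to \<open>0..n\<close>.\<close>
  also have "\<dots> = (\<Sum>d\<in>(\<lambda>k. k * i) ` ?K. fps_nth (\<Prod>i\<in>S. part_gf (C i) i :: 'a fps) (n - d))"
    using i by (subst sum.reindex) (auto simp: inj_on_def)
  also have "\<dots> = (\<Sum>d=0..n. fps_nth (part_gf (C i) i) d *
      fps_nth (\<Prod>i\<in>S. part_gf (C i) i :: 'a fps) (n - d))"
    using i by (intro sum.mono_neutral_cong_left)
      (auto simp: part_gf_def image_iff mult.commute elim!: dvdE)
  also have "\<dots> = fps_nth (\<Prod>i\<in>insert i S. part_gf (C i) i) n"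
    using insert.hyps by (simp add: fps_mult_nth)
  finally show ?case .
qed

section \<open>Elements of \<open>P_od\<close> with a given mex\<close>

text \<open>The multiplicities that part \<open>i\<close> may have in an element of \<open>P_od\<close> with mex \<open>m\<close>.\<close>

definition mex_mults :: "nat \<Rightarrow> nat \<Rightarrow> nat set" where
  "mex_mults m i =
    (if i < m then if odd i then {1} else {0<..}
     else if i = m then {0} else if odd i then {0, 1} else UNIV)"

lemma mex_pos: "mex l > 0" and mex_notin: "mex l \<notin># l"
proof -
  have "\<exists>x. 0 < x \<and> x \<notin># l"
  proof (rule ccontr)
    assume "\<not> ?thesis"
    hence "{0<..} \<subseteq> set_mset l" by blast
    thus False
      using finite_subset infinite_Ioi by blast
  qed
  from LeastI_ex[OF this] show "mex l > 0" "mex l \<notin># l" by (simp_all add: mex_def)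
qed

lemma mem_if_less_mex: "0 < i \<Longrightarrow> i < mex l \<Longrightarrow> i \<in># l"
  using not_less_Least[of i "\<lambda>m. 0 < m \<and> m \<notin># l"] by (auto simp: mex_def)

lemma mex_eq_iff:
  assumes "m > 0"
  shows "mex l = m \<longleftrightarrow> m \<notin># l \<and> (\<forall>i. 0 < i \<and> i < m \<longrightarrow> i \<in># l)"
  using assms mex_pos[of l] mex_notin[of l] mem_if_less_mex[of _ l]
  by (metis linorder_neqE_nat)

lemma P_od_part_le: "l \<in> P_od n \<Longrightarrow> i \<in># l \<Longrightarrow> i \<le> n"
  by (auto simp: P_od_def dest!: multi_member_split)

text \<open>Otherwise \<open>Suc n\<close> would be a part of a partition of \<open>n\<close>. Hence
  only finitely many mex values matter for each coefficient.\<close>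

lemma mex_le_Suc: "l \<in> P_od n \<Longrightarrow> mex l \<le> Suc n"
  using P_od_part_le[of l n "Suc n"] mem_if_less_mex[of "Suc n" l] by force

text \<open>Truncating the part sizes at \<open>N\<close> loses nothing: parts are at most
  \<open>n\<close>, and \<open>m \<le> N\<close> keeps every condition that defines the mex within
  range.\<close>

lemma P_od_mex_eq_msets:
  assumes "0 < m" "m \<le> N" "n \<le> N"
  shows "{l \<in> P_od n. mex l = m} = msets {1..N} (mex_mults m) n"
proof (intro equalityI subsetI)
  fix l assume "l \<in> {l \<in> P_od n. mex l = m}"
  hence l: "l \<in> P_od n" and m: "mex l = m" by auto
  have "set_mset l \<subseteq> {1..N}"
  proof
    fix i assume "i \<in># l"
    moreover from this have "i \<noteq> 0" using l by (metis (mono_tags, lifting) P_od_def mem_Collect_eq)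
    ultimately show "i \<in> {1..N}" using P_od_part_le[OF l] assms(3) by force
  qed
  moreover have "count l i \<in> mex_mults m i" if "i \<in> {1..N}" for i
  proof -
    have "count l i \<le> 1" if "odd i" using l that by (simp add: P_od_def)
    moreover have "count l i > 0" if "i < m"
      using that \<open>i \<in> {1..N}\<close> m mem_if_less_mex[of i l] by simp
    moreover have "count l i = 0" if "i = m"
      using mex_notin[of l] that m by (simp add: count_eq_zero_iff)
    ultimately show ?thesis
      by (auto simp: mex_mults_def simp del: count_greater_zero_iff)
  qed
  ultimately show "l \<in> msets {1..N} (mex_mults m) n"
    using l by (simp add: msets_def P_od_def)
next
  fix l assume "l \<in> msets {1..N} (mex_mults m) n"
  hence sub: "set_mset l \<subseteq> {1..N}" and n: "sum_mset l = n"
    and C: "\<And>i. i \<in> {1..N} \<Longrightarrow> count l i \<in> mex_mults m i"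
    by (auto simp: msets_def)
  have "count l i \<le> 1" if "odd i" for i
  proof (cases "i \<in> {1..N}")
    case True
    thus ?thesis using C[OF True] that by (auto simp: mex_mults_def split: if_splits)
  next
    case False
    hence "i \<notin># l" using sub by blast
    thus ?thesis by (simp add: not_in_iff)
  qed
  hence "l \<in> P_od n" using sub n by (auto simp: P_od_def)
  moreover have "m \<notin># l"
    using C[of m] assms by (simp add: mex_mults_def not_in_iff)
  moreover have "i \<in># l" if "0 < i" "i < m" for i
    using C[of i] that assms by (auto simp: mex_mults_def split: if_splits simp flip: count_greater_zero_iff)
  ultimately show "l \<in> {l \<in> P_od n. mex l = m}"
    using assms by (simp add: mex_eq_iff)
qed

section \<open>Finite products in closed form\<close>

text \<open>Padding with 1 keeps the index set \<open>1..N\<close>, so that products over even and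
  over odd sizes can be compared factor by factor.\<close>

lemma prod_even_eq_qpoch:
  "(\<Prod>i=1..N. if even i then 1 - q ^ i else 1) = qpoch (q\<^sup>2) (q\<^sup>2) (N div 2)"
proof (induction N)
  case (Suc N)
  show ?case
  proof (cases "even N")
    case True
    thus ?thesis using Suc by simp
  next
    case False
    then obtain j where "N = 2 * j + 1" by (elim oddE)
    thus ?thesis using Suc by (simp add: qpoch_def power_mult power2_eq_square)
  qed
qed (simp add: qpoch_def)

lemma prod_odd_eq_qpoch:
  "(\<Prod>i=1..N. if odd i then 1 + q ^ i else 1) = qpoch (- q) (q\<^sup>2) ((N + 1) div 2)"
proof (induction N)
  case (Suc N)
  show ?case
  proof (cases "even N")
    case False
    thus ?thesis using Suc by simp
  next
    case True
    then obtain j where "N = 2 * j" by (elim evenE)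
    thus ?thesis using Suc by (simp add: qpoch_def power_mult)
  qed
qed (simp add: qpoch_def)

definition mex_gf_numer :: "nat \<Rightarrow> rat fps" where
  "mex_gf_numer m = q ^ (\<Sum>i<m. i) * (if even m then 1 - q ^ m else 1)"

text \<open>Both denominators are cleared so that passing to the limit only needs continuity of
  multiplication.\<close>

lemma prod_mex_mults:
  assumes "0 < m" "m \<le> 2 * M"
  shows "(\<Prod>i=1..2*M. part_gf (mex_mults m i) i) *
           (qpoch (q\<^sup>2) (q\<^sup>2) M * qpoch (- q) (q\<^sup>2) ((m + 1) div 2)) =
         qpoch (- q) (q\<^sup>2) M * mex_gf_numer m"
proof -
  let ?S = "{1..2*M}"
  \<comment> \<open>The identity already holds for each \<open>i\<close>; the cases are the position
    of \<open>i\<close> relative to \<open>m\<close> and the parity of \<open>i\<close>.\<close>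
  have factor: "part_gf (mex_mults m i) i * ((if even i then 1 - q ^ i else 1) *
       (if odd i \<and> i \<le> m then 1 + q ^ i else 1)) =
      (if odd i then 1 + q ^ i else 1) * ((if i < m then q ^ i else 1) *
       (if i = m then if even m then 1 - q ^ m else 1 else 1))" if "i \<in> ?S" for i
  proof -
    have "i > 0" using that by simp
    note gf = part_gf_0[OF this] part_gf_1[OF this] part_gf_0_1[OF this] part_gf_UNIV[OF this]
      part_gf_pos[OF this]
    show ?thesis
      using gf by (cases i m rule: linorder_cases; cases "even i") (auto simp: mex_mults_def mult.commute)
  qed
  have "(\<Prod>i\<in>?S. if odd i \<and> i \<le> m then 1 + q ^ i else 1) =
      (\<Prod>i=1..m. if odd i then 1 + q ^ i else 1)"
    using assms by (intro prod.mono_neutral_cong_right) auto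
  hence odd_le: "(\<Prod>i\<in>?S. if odd i \<and> i \<le> m then 1 + q ^ i else 1) =
      qpoch (- q) (q\<^sup>2) ((m + 1) div 2)"
    using prod_odd_eq_qpoch[of m] by simp
  have "(\<Prod>i\<in>?S. if i < m then q ^ i else 1) = (\<Prod>i<m. q ^ i)"
    using assms by (intro prod.mono_neutral_cong) (auto simp: Suc_le_eq)
  hence below: "(\<Prod>i\<in>?S. if i < m then q ^ i else 1) = q ^ (\<Sum>i<m. i)"
    by (simp add: power_sum)
  have at: "(\<Prod>i\<in>?S. if i = m then if even m then 1 - q ^ m else 1 else 1) =
      (if even m then 1 - q ^ m else 1)"
    using assms by (subst prod.delta) auto
  \<comment> \<open>The upper bound \<open>2 * M\<close> gives exactly \<open>M\<close> even and
    \<open>M\<close> odd sizes.\<close>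
  have M: "2 * M div 2 = M" "(2 * M + 1) div 2 = M"
    by simp_all
  show ?thesis
    using prod.cong[OF refl factor, of ?S "\<lambda>i. i"]
    by (simp only: prod.distrib prod_even_eq_qpoch prod_odd_eq_qpoch odd_le below at
        mex_gf_numer_def M)
qed

section \<open>The generating function for a fixed mex\<close>

lemma qpoch_tendsto_inf:
  fixes a :: "rat fps"
  assumes "fps_nth a 0 = 0"
  shows "qpoch a (q\<^sup>2) \<longlonglongrightarrow> qpoch_inf a (q\<^sup>2)"
  using convergent_qpoch_fps[OF assms] by (simp add: convergent_LIMSEQ_iff qpoch_inf_def)

text \<open>Makes the infinite product a unit, so that division by it is multiplication by its
  inverse.\<close>

lemma qpoch_inf_nth_0: "fps_nth (qpoch_inf (q\<^sup>2) (q\<^sup>2)) 0 = 1"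
proof -
  have "fps_nth (qpoch (q\<^sup>2) (q\<^sup>2) n) 0 = 1" for n
    by (induction n) (auto simp: qpoch_def)
  moreover have "\<forall>\<^sub>F n in sequentially. fps_nth (qpoch (q\<^sup>2) (q\<^sup>2) n) 0 = fps_nth (qpoch_inf (q\<^sup>2) (q\<^sup>2)) 0"
    using qpoch_tendsto_inf[of "q\<^sup>2"] by (simp add: tendsto_fps_iff)
  ultimately show ?thesis by simp
qed

definition mex_gf :: "nat \<Rightarrow> rat fps" where
  "mex_gf m = Abs_fps (\<lambda>n. of_nat (card {l \<in> P_od n. mex l = m}))"

lemma mex_gf_0: "mex_gf 0 = 0"
  using mex_pos by (simp add: mex_gf_def fps_eq_iff less_imp_neq[THEN not_sym])

text \<open>Coefficient \<open>n\<close> of the finite product is exact once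
  \<open>M \<ge> max m n\<close>, so the products tend to \<open>mex_gf m\<close>. The limit of
  \<open>prod_mex_mults\<close> then determines it after division by units.\<close>

lemma mex_gf_eq:
  "mex_gf m = qpoch_inf (- q) (q\<^sup>2) / qpoch_inf (q\<^sup>2) (q\<^sup>2) *
     (mex_gf_numer m / qpoch (- q) (q\<^sup>2) ((m + 1) div 2))"
proof (cases "m = 0")
  case True
  \<comment> \<open>Both sides vanish, the right one through the factor
    \<open>1 - q ^ 0\<close>.\<close>
  thus ?thesis by (simp add: mex_gf_0 mex_gf_numer_def)
next
  case False
  let ?D = "qpoch (- q) (q\<^sup>2) ((m + 1) div 2)"
  let ?Q = "qpoch_inf (q\<^sup>2) (q\<^sup>2)" and ?P = "qpoch_inf (- q) (q\<^sup>2)"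
  let ?F = "\<lambda>M. (\<Prod>i=1..2*M. part_gf (mex_mults m i) i) :: rat fps"
  have "?F \<longlonglongrightarrow> mex_gf m"
    unfolding tendsto_fps_iff
  proof
    fix n
    have "fps_nth (?F M) n = fps_nth (mex_gf m) n" if "M \<ge> max m n" for M
      using that False P_od_mex_eq_msets[of m "2 * M" n]
      by (simp add: mex_gf_def card_msets)
    thus "\<forall>\<^sub>F M in sequentially. fps_nth (?F M) n = fps_nth (mex_gf m) n"
      unfolding eventually_sequentially by blast
  qed
  hence "(\<lambda>M. ?F M * (qpoch (q\<^sup>2) (q\<^sup>2) M * ?D)) \<longlonglongrightarrow> mex_gf m * (?Q * ?D)"
    by (intro tendsto_fps_mult tendsto_const qpoch_tendsto_inf) auto
  moreover have "\<forall>\<^sub>F M in sequentially. ?F M * (qpoch (q\<^sup>2) (q\<^sup>2) M * ?D) =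
      qpoch (- q) (q\<^sup>2) M * mex_gf_numer m"
    using eventually_ge_at_top[of m] by eventually_elim (use False prod_mex_mults in auto)
  ultimately have "(\<lambda>M. qpoch (- q) (q\<^sup>2) M * mex_gf_numer m) \<longlonglongrightarrow> mex_gf m * (?Q * ?D)"
    by (rule Lim_transform_eventually)
  moreover have "(\<lambda>M. qpoch (- q) (q\<^sup>2) M * mex_gf_numer m) \<longlonglongrightarrow> ?P * mex_gf_numer m"
    by (intro tendsto_fps_mult tendsto_const qpoch_tendsto_inf) auto
  ultimately have eq: "mex_gf m * (?Q * ?D) = ?P * mex_gf_numer m"
    using LIMSEQ_unique by blast
  have units: "?Q * inverse ?Q = 1" "?D * inverse ?D = 1"
    by (simp_all add: inverse_mult_eq_1' qpoch_inf_nth_0 qpoch_nth_0)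
  have "mex_gf m = mex_gf m * ((?Q * inverse ?Q) * (?D * inverse ?D))"
    unfolding units by simp
  also have "\<dots> = mex_gf m * (?Q * ?D) * (inverse ?Q * inverse ?D)"
    by (simp only: mult_ac)
  also have "\<dots> = (?P * inverse ?Q) * (mex_gf_numer m * inverse ?D)"
    unfolding eq by (simp only: mult_ac)
  finally show ?thesis
    by (simp add: fps_divide_unit qpoch_inf_nth_0 qpoch_nth_0)
qed

section \<open>Summation over the mex\<close>

text \<open>Here \<open>f\<close> enumerates the admissible mex values. By
  \<open>mex_le_Suc\<close>, coefficient \<open>n\<close> receives contributions only from
  \<open>f k \<le> Suc n\<close>, hence from finitely many \<open>k\<close> by injectivity.\<close>

lemma sums_mex_gf:
  assumes "inj f" and "range f = {m. R m}"
  shows "(\<lambda>k. mex_gf (f k)) sums Abs_fps (\<lambda>n. of_nat (card {l \<in> P_od n. R (mex l)}))"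
  unfolding sums_def tendsto_fps_iff
proof
  fix n
  have fin: "finite (f -` {..Suc n})"
    using assms(1) by (intro finite_vimageI) auto
  have "fps_nth (\<Sum>k<N. mex_gf (f k)) n = of_nat (card {l \<in> P_od n. R (mex l)})"
    if N: "f -` {..Suc n} \<subseteq> {..<N}" for N
  proof -
    have "{l \<in> P_od n. R (mex l)} = (\<Union>k<N. {l \<in> P_od n. mex l = f k})"
    proof (intro equalityI subsetI)
      fix l assume l: "l \<in> {l \<in> P_od n. R (mex l)}"
      then obtain k where k: "mex l = f k" using assms(2) by blast
      moreover have "k < N" using N l mex_le_Suc[of l n] k by auto
      ultimately show "l \<in> (\<Union>k<N. {l \<in> P_od n. mex l = f k})" using l by auto
    qed (use assms(2) in auto)
    moreover have "card (\<Union>k<N. {l \<in> P_od n. mex l = f k}) = (\<Sum>k<N. card {l \<in> P_od n. mex l = f k})"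
      using assms(1) by (intro card_UN_disjoint) (auto simp: finite_P_od inj_def)
    ultimately show ?thesis by (simp add: fps_sum_nth mex_gf_def)
  qed
  note coeff = this
  obtain N0 where "f -` {..Suc n} \<subseteq> {..<N0}"
    using fin unfolding finite_nat_set_iff_bounded by blast
  hence bound: "f -` {..Suc n} \<subseteq> {..<N}" if "N \<ge> N0" for N
    using that by (meson lessThan_subset_iff order_trans)
  show "\<forall>\<^sub>F N in sequentially. fps_nth (\<Sum>k<N. mex_gf (f k)) n =
      fps_nth (Abs_fps (\<lambda>n. of_nat (card {l \<in> P_od n. R (mex l)}))) n"
    unfolding eventually_sequentially fps_nth_Abs_fps
    by (intro exI[of _ N0] allI impI coeff bound)
qed

lemma sum_lessThan_odd: "(\<Sum>i<2 * k + 1. i) = 2 * k\<^sup>2 + (k :: nat)"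
  by (induction k) (auto simp: power2_eq_square)

text \<open>Drop the last term \<open>2 * k\<close> from the odd case.\<close>

lemma sum_lessThan_even: "(\<Sum>i<2 * k. i) = 2 * k\<^sup>2 - (k :: nat)"
  using sum_lessThan_odd[of k] by simp

theorem theorem1p1:
  shows "Abs_fps (\<lambda>n. of_nat (a_od_o n)) =
           qpoch_inf (- q) (q\<^sup>2) / qpoch_inf (q\<^sup>2) (q\<^sup>2) *
             (\<Sum>n. q ^ (2 * n\<^sup>2 + n) / qpoch (- q) (q\<^sup>2) (n + 1))
       \<and> Abs_fps (\<lambda>n. of_nat (a_od_e n)) =
           qpoch_inf (- q) (q\<^sup>2) / qpoch_inf (q\<^sup>2) (q\<^sup>2) *
             (v2 - (\<Sum>n. q ^ (2 * n\<^sup>2 + n) / qpoch (- q) (q\<^sup>2) n))"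
proof
  let ?R = "qpoch_inf (- q) (q\<^sup>2) / qpoch_inf (q\<^sup>2) (q\<^sup>2)"
  have "(\<lambda>k. mex_gf (2 * k + 1)) sums Abs_fps (\<lambda>n. of_nat (a_od_o n))"
    unfolding a_od_o_def by (rule sums_mex_gf) (auto simp: inj_def elim!: oddE)
  moreover have "mex_gf (2 * k + 1) = ?R * (q ^ (2 * k\<^sup>2 + k) / qpoch (- q) (q\<^sup>2) (k + 1))" for k
    unfolding mex_gf_eq mex_gf_numer_def sum_lessThan_odd by simp
  ultimately have "(\<lambda>n. ?R * (q ^ (2 * n\<^sup>2 + n) / qpoch (- q) (q\<^sup>2) (n + 1))) sums
      Abs_fps (\<lambda>n. of_nat (a_od_o n))"
    by (simp only:)
  moreover have "(\<lambda>n. ?R * (q ^ (2 * n\<^sup>2 + n) / qpoch (- q) (q\<^sup>2) (n + 1))) sums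
      (?R * (\<Sum>n. q ^ (2 * n\<^sup>2 + n) / qpoch (- q) (q\<^sup>2) (n + 1)))"
    by (intro sums_fps_mult_left summable_sums summable_fps_X_power_div_qpoch) simp
  ultimately show "Abs_fps (\<lambda>n. of_nat (a_od_o n)) =
      ?R * (\<Sum>n. q ^ (2 * n\<^sup>2 + n) / qpoch (- q) (q\<^sup>2) (n + 1))"
    by (rule sums_unique2)
next
  let ?R = "qpoch_inf (- q) (q\<^sup>2) / qpoch_inf (q\<^sup>2) (q\<^sup>2)"
  let ?t = "\<lambda>n. q ^ (2 * n\<^sup>2 - n) / qpoch (- q) (q\<^sup>2) n - q ^ (2 * n\<^sup>2 + n) / qpoch (- q) (q\<^sup>2) n"
  \<comment> \<open>This bound gives summability of the series \<open>v2\<close>; it also supports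
    \<open>exp\<close>, where the natural subtraction must not truncate.\<close>
  have le: "k \<le> 2 * k\<^sup>2 - k" for k :: nat
    by (cases k) (auto simp: power2_eq_square)
  \<comment> \<open>With this, \<open>?t k\<close> is
    \<open>q ^ (2 * k\<^sup>2 - k) * (1 - q ^ (2 * k))\<close> over the Pochhammer symbol, which is
    the shape of \<open>mex_gf_eq\<close> at \<open>2 * k\<close>.\<close>
  have exp: "2 * k\<^sup>2 + k = (2 * k\<^sup>2 - k) + 2 * k" for k :: nat
    using le[of k] by (cases k) auto
  have "(\<lambda>k. mex_gf (2 * k)) sums Abs_fps (\<lambda>n. of_nat (a_od_e n))"
    \<comment> \<open>The value \<open>0\<close> at \<open>k = 0\<close> is even but never a mex, so
      it adds nothing.\<close>
    unfolding a_od_e_def by (rule sums_mex_gf) (auto simp: inj_def elim!: evenE)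
  moreover have "mex_gf (2 * k) = ?R * ?t k" for k
    unfolding mex_gf_eq mex_gf_numer_def sum_lessThan_even exp power_add
    by (simp add: fps_divide_unit qpoch_nth_0 algebra_simps)
  ultimately have "(\<lambda>k. ?R * ?t k) sums Abs_fps (\<lambda>n. of_nat (a_od_e n))"
    by (simp only:)
  moreover have "(\<lambda>k. ?R * ?t k) sums
      (?R * (v2 - (\<Sum>n. q ^ (2 * n\<^sup>2 + n) / qpoch (- q) (q\<^sup>2) n)))"
    unfolding v2_def using le
    by (intro sums_fps_mult_left sums_fps_diff summable_sums summable_fps_X_power_div_qpoch) auto
  ultimately show "Abs_fps (\<lambda>n. of_nat (a_od_e n)) =
      ?R * (v2 - (\<Sum>n. q ^ (2 * n\<^sup>2 + n) / qpoch (- q) (q\<^sup>2) n))"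
    by (rule sums_unique2)
qed

end
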